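(* Let $P\colon\mathbb{C}\to\mathbb{C}$ be a polynomial (of degree $d\ge2$) with exactly two finite postcritical points and no finite periodic critical points. Then $P$ is not renormalizable.
   Context: The postcritical set of $P$ is $\bigcup_{n\ge1}P^n(\operatorname{crit}(P))$, where critical points are taken in $\mathbb{C}$ (finite critical points); a critical point $c$ is periodic if $P^n(c)=c$ for some $n\in\mathbb{N}$. A polynomial-like map of degree $\delta\ge1$ is a triple $(f,U,V)$ where $U,V\subset\mathbb{C}$ are Jordan domains, $\overline U$ is a compact subset of $V$, and $f\colon U\to V$ is a proper holomorphic map of degree $\delta$; its filled Julia set is $\mathcal{K}(f|U)=\bigcap_{n\ge0}(f|U)^{-n}(U)$. For a polynomial $P$ of degree $d\ge2$ with connected Julia set and $n\in\mathbb{N}$, $P^n\colon U\to V$ is a renormalization of $P$ if (1) $(P^n,U,V)$ is a polynomial-like map, (2) $\mathcal{K}(P^n|U)$ is connected, and (3) its degree $\delta$ satisfies $2\le\delta<d^n$. $P$ is renormalizable if a renormalization exists for some $n\in\mathbb{N}$. *)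

theory Defs
  imports "HOL-Analysis.Analysis" "HOL-Computational_Algebra.Polynomial"
begin

definition poly_iter :: "complex poly \<Rightarrow> nat \<Rightarrow> complex poly" where
  "poly_iter P n = ((\<lambda>q. pcompose P q) ^^ n) [:0, 1:]"

definition crit_points :: "complex poly \<Rightarrow> complex set" where
  "crit_points P = {c. poly (pderiv P) c = 0}"

definition postcritical_set :: "complex poly \<Rightarrow> complex set" where
  "postcritical_set P = (\<Union>n\<in>{1..}. (poly P ^^ n) ` crit_points P)"

definition periodic_point :: "complex poly \<Rightarrow> complex \<Rightarrow> bool" where
  "periodic_point P c \<longleftrightarrow> (\<exists>n\<ge>1. (poly P ^^ n) c = c)"

definition filled_julia :: "complex poly \<Rightarrow> complex set" where
  "filled_julia P = {z. bounded (range (\<lambda>k. (poly P ^^ k) z))}"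

definition julia_set :: "complex poly \<Rightarrow> complex set" where
  "julia_set P = frontier (filled_julia P)"

definition jordan_domain :: "complex set \<Rightarrow> bool" where
  "jordan_domain U \<longleftrightarrow> (\<exists>g. simple_path g \<and> pathfinish g = pathstart g \<and> U = inside (path_image g))"

definition polynomial_like :: "complex poly \<Rightarrow> complex set \<Rightarrow> complex set \<Rightarrow> nat \<Rightarrow> bool" where
  "polynomial_like Q U V \<delta> \<longleftrightarrow>
     jordan_domain U \<and> jordan_domain V \<and> compact (closure U) \<and> closure U \<subseteq> V \<and>
     \<delta> \<ge> 1 \<and>
     poly Q ` U \<subseteq> V \<and>
     (\<forall>K. compact K \<and> K \<subseteq> V \<longrightarrow> compact {z\<in>U. poly Q z \<in> K}) \<and>
     (\<forall>w\<in>V. finite {z\<in>U. poly Q z = w} \<and>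
             (\<Sum>z\<in>{z\<in>U. poly Q z = w}. order z (Q - [:w:])) = \<delta>)"

definition filled_julia_restr :: "complex poly \<Rightarrow> complex set \<Rightarrow> complex set" where
  "filled_julia_restr Q U = {z. \<forall>k. (poly Q ^^ k) z \<in> U}"

text \<open>P^n : U \<rightarrow> V is a renormalization of P (P of degree d \<ge> 2 with connected Julia set).\<close>
definition renormalization :: "complex poly \<Rightarrow> nat \<Rightarrow> complex set \<Rightarrow> complex set \<Rightarrow> bool" where
  "renormalization P n U V \<longleftrightarrow>
     (\<exists>\<delta>. polynomial_like (poly_iter P n) U V \<delta> \<and>
          connected (filled_julia_restr (poly_iter P n) U) \<and>
          2 \<le> \<delta> \<and> \<delta> < degree P ^ n)"

definition renormalizable :: "complex poly \<Rightarrow> bool" where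
  "renormalizable P \<longleftrightarrow> degree P \<ge> 2 \<and> connected (julia_set P) \<and>
     (\<exists>n\<ge>1. \<exists>U V. renormalization P n U V)"

end

theory Submission
  imports
    Defs
    "HOL-Complex_Analysis.Riemann_Mapping"
    "HOL-Computational_Algebra.Fundamental_Theorem_Algebra"
begin

text \<open>
  Put $F = P^n$ and let $a, b$ be the postcritical points; all critical values of $F$ lie in
  $\{a,b\}$, which $F$ maps into itself. If $a, b \in V$, then $F^{-1}(V)$ is connected, so it equals
  $U$ and the degree is $d^n$. If $V$ contains at most one critical value $s$, then
  $F \colon U \setminus F^{-1}(s) \to V \setminus \{s\}$ is a covering of a punctured disc, so $s$ has
  a single, critical, preimage in $U$. Connectedness of the filled Julia set forces $s \in U$:
  otherwise each component of $U \cap F^{-1}(U)$ maps bijectively onto $U$, so there are several, and each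
  meets the filled Julia set. Hence $F(s) = s$ and $s$ is a periodic critical point.
\<close>

section \<open>Proper maps and covering spaces\<close>

text \<open>Properness relative to the target set \<open>Y\<close>, in the form of the two clauses
  that \<open>polynomial_like\<close> provides. Continuity is kept as a separate assumption.\<close>

definition proper_into :: "'a::topological_space set \<Rightarrow> 'b::topological_space set \<Rightarrow> ('a \<Rightarrow> 'b) \<Rightarrow> bool" where
  "proper_into X Y f \<longleftrightarrow>
     f ` X \<subseteq> Y \<and> (\<forall>K. compact K \<and> K \<subseteq> Y \<longrightarrow> compact {x\<in>X. f x \<in> K})"

lemma proper_intoD:
  assumes "proper_into X Y f" "compact K" "K \<subseteq> Y"
  shows "compact {x\<in>X. f x \<in> K}"
  using assms by (auto simp: proper_into_def)

lemma proper_into_closedin_image: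
  fixes f :: "'a::heine_borel \<Rightarrow> 'b::heine_borel"
  assumes "proper_into X Y f" "closedin (top_of_set X) S"
  shows "closedin (top_of_set Y) (f ` S)"
proof (rule proper_map [OF assms(2)])
  fix K assume "K \<subseteq> Y" "compact K"
  moreover have "X \<inter> f -` K = {x\<in>X. f x \<in> K}" by auto
  ultimately show "compact (X \<inter> f -` K)"
    using assms(1) by (simp add: proper_intoD)
qed (use assms in \<open>auto simp: proper_into_def\<close>)

text \<open>A fibre is compact and, by local injectivity, discrete, hence finite. Invariance of
  domain makes \<open>f\<close> a homeomorphism near each of its points, which is why both sides
  share one Euclidean type, and properness keeps points of \<open>X\<close> far from the fibre from
  being mapped close to \<open>w\<close>.\<close>

lemma proper_into_local_injection_covering_space:
  fixes f :: "'a::euclidean_space \<Rightarrow> 'a"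
  assumes "open X" "open Y" and cont: "continuous_on X f" and pr: "proper_into X Y f"
    and onto: "f ` X = Y"
    and inj: "\<And>x. x \<in> X \<Longrightarrow> \<exists>N. open N \<and> x \<in> N \<and> N \<subseteq> X \<and> inj_on f N"
  shows "covering_space X f Y"
proof
  fix w assume w: "w \<in> Y"
  define \<Phi> where "\<Phi> = {x\<in>X. f x \<in> {w}}"
  have "compact \<Phi>"
    unfolding \<Phi>_def using w by (intro proper_intoD [OF pr]) auto
  obtain N where N: "\<And>x. x \<in> X \<Longrightarrow> open (N x) \<and> x \<in> N x \<and> N x \<subseteq> X \<and> inj_on f (N x)"
    using inj by metis
  obtain D where D: "D \<subseteq> \<Phi>" "finite D" "\<Phi> \<subseteq> (\<Union>x\<in>D. N x)"
  proof (rule compactE_image [OF \<open>compact \<Phi>\<close>, of \<Phi> N])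
    show "\<Phi> \<subseteq> (\<Union>x\<in>\<Phi>. N x)" using N by (auto simp: \<Phi>_def)
  qed (use N in \<open>auto simp: \<Phi>_def\<close>)
  \<comment> \<open>By injectivity \<open>N y\<close> contains only one point of the fibre, so the
    finite subcover exhausts the fibre.\<close>
  have "\<Phi> \<subseteq> D"
  proof
    fix x assume x: "x \<in> \<Phi>"
    then obtain y where y: "y \<in> D" "x \<in> N y" using D by blast
    moreover have "inj_on f (N y)" "y \<in> N y" "f x = f y"
      using N[of y] y D x by (auto simp: \<Phi>_def)
    ultimately show "x \<in> D" by (metis inj_onD)
  qed
  then have fin: "finite \<Phi>" using D finite_subset by blast
  have ne: "\<Phi> \<noteq> {}" using w onto by (auto simp: \<Phi>_def)
  have "\<exists>r>0. ball x r \<subseteq> N x \<and> (\<forall>y\<in>\<Phi>. y \<noteq> x \<longrightarrow> r \<le> dist x y)" if x: "x \<in> \<Phi>" for x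
  proof -
    obtain r where r: "r > 0" "ball x r \<subseteq> N x"
      using N[of x] x by (auto simp: \<Phi>_def open_contains_ball)
    obtain s where s: "s > 0" "\<And>y. y \<in> \<Phi> \<Longrightarrow> y \<noteq> x \<Longrightarrow> s \<le> dist x y"
      using finite_set_avoid [OF fin, of x] by auto
    show ?thesis
      by (rule exI [of _ "min r s"]) (use r s in \<open>auto simp: min_le_iff_disj\<close>)
  qed
  then obtain r where r: "\<And>x. x \<in> \<Phi> \<Longrightarrow> r x > 0 \<and> ball x (r x) \<subseteq> N x \<and> (\<forall>y\<in>\<Phi>. y \<noteq> x \<longrightarrow> r x \<le> dist x y)"
    by metis
  \<comment> \<open>Half of the smallest separation radius, so that balls about distinct fibre
    points are disjoint.\<close>
  define \<delta> where "\<delta> = Min (r ` \<Phi>) / 2"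
  have \<delta>: "\<delta> > 0" "\<And>x. x \<in> \<Phi> \<Longrightarrow> 2 * \<delta> \<le> r x"
    using fin ne r by (auto simp: \<delta>_def)
  define B where "B x = ball x \<delta>" for x :: 'a
  have BX: "open (B x)" "x \<in> B x" "B x \<subseteq> X" "inj_on f (B x)" "continuous_on (B x) f" if "x \<in> \<Phi>" for x
  proof -
    have "B x \<subseteq> N x" "x \<in> X"
      using that r[of x] \<delta>(1) \<delta>(2)[of x] by (auto simp: B_def \<Phi>_def)
    then show "open (B x)" "x \<in> B x" "B x \<subseteq> X" "inj_on f (B x)" "continuous_on (B x) f"
      using N[of x] \<delta>(1) cont by (auto simp: B_def intro: inj_on_subset continuous_on_subset)
  qed
  have disj: "B x \<inter> B y = {}" if "x \<in> \<Phi>" "y \<in> \<Phi>" "x \<noteq> y" for x y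
  proof (rule ccontr)
    assume "B x \<inter> B y \<noteq> {}"
    then obtain z where "dist x z < \<delta>" "dist y z < \<delta>" by (auto simp: B_def)
    then have "dist x y < 2 * \<delta>" using dist_triangle2[of x y z] by linarith
    then show False using r[of x] \<delta>(2)[of x] that by fastforce
  qed
  define G where "G = (\<Union>x\<in>\<Phi>. B x)"
  \<comment> \<open>Discarding the image of \<open>X - G\<close> confines the preimage of
    \<open>T\<close> to the balls; the intersection lets every ball reach all of
    \<open>T\<close>.\<close>
  define T where "T = (Y - f ` (X - G)) \<inter> (\<Inter>x\<in>\<Phi>. f ` B x)"
  have "open G" using BX by (auto simp: G_def)
  then have "closedin (top_of_set X) (X - G)"
    by (metis Diff_Int_distrib2 closedin_def openin_open_Int inf.idem inf_commute
        openin_open Diff_Diff_Int topspace_euclidean_subtopology Diff_subset)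
  then have "closedin (top_of_set Y) (f ` (X - G))"
    by (rule proper_into_closedin_image [OF pr])
  then have op1: "open (Y - f ` (X - G))"
    using \<open>open Y\<close> by (metis openin_diff openin_open_eq openin_subtopology_self)
  have op2: "open (\<Inter>x\<in>\<Phi>. f ` B x)"
    using fin BX by (intro open_INT ballI invariance_of_domain) auto
  have oT: "open T" unfolding T_def using op1 op2 by blast
  have TY: "T \<subseteq> Y" by (auto simp: T_def)
  have wT: "w \<in> T"
  proof -
    have "w \<in> f ` B x" if "x \<in> \<Phi>" for x
      using BX(2)[OF that] that by (auto simp: \<Phi>_def)
    moreover have "w \<notin> f ` (X - G)"
      using BX(2) by (auto simp: \<Phi>_def G_def)
    ultimately show ?thesis using w by (auto simp: T_def)
  qed
  have homeo: "\<exists>q. homeomorphism (B x \<inter> f -` T) T f q" if x: "x \<in> \<Phi>" for x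
  proof -
    have "open (B x \<inter> f -` T)"
      using BX[OF x] oT by (intro continuous_open_preimage)
    moreover have "f ` (B x \<inter> f -` T) = T"
    proof -
      have "T \<subseteq> f ` B x" using x by (auto simp: T_def)
      then show ?thesis by blast
    qed
    ultimately show ?thesis
      using invariance_of_domain_homeomorphism [of "B x \<inter> f -` T" f] BX[OF x]
      by (metis continuous_on_subset inf_le1 inj_on_subset order_refl)
  qed
  define v where "v = (\<lambda>x. B x \<inter> f -` T) ` \<Phi>"
  have v1: "\<Union>v = X \<inter> f -` T"
    using BX(3) by (auto simp: v_def T_def G_def)
  have v2: "openin (top_of_set X) u" if "u \<in> v" for u
  proof -
    obtain x where x: "x \<in> \<Phi>" "u = B x \<inter> f -` T" using \<open>u \<in> v\<close> by (auto simp: v_def)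
    have "open u"
      unfolding x using BX[OF x(1)] oT by (intro continuous_open_preimage)
    then show ?thesis
      using BX(3)[OF x(1)] x(2) \<open>open X\<close> by (simp add: openin_open_eq le_infI1)
  qed
  have v3: "pairwise disjnt v"
    using disj by (fastforce simp: pairwise_def v_def disjnt_def)
  show "\<exists>T. w \<in> T \<and> openin (top_of_set Y) T \<and> (\<exists>v. \<Union>v = X \<inter> f -` T \<and>
          (\<forall>u\<in>v. openin (top_of_set X) u) \<and> pairwise disjnt v \<and> (\<forall>u\<in>v. \<exists>q. homeomorphism u T f q))"
  proof (intro exI conjI)
    show "openin (top_of_set Y) T" using oT TY \<open>open Y\<close> by (simp add: openin_open_eq)
  qed (use wT v1 v2 v3 homeo in \<open>auto simp: v_def\<close>)
qed (use assms in auto)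

text \<open>The exponential lifts through \<^term>\<open>p\<close> to a surjection onto \<^term>\<open>X\<close>, because paths in
  \<^term>\<open>Y\<close> lift through both maps.\<close>

lemma covering_space_connected_preimage:
  fixes p :: "complex \<Rightarrow> complex"
  assumes cov: "covering_space X p Y" and "0 \<notin> Y" and X: "path_connected X"
    and H: "simply_connected {z. exp z \<in> Y}" "locally path_connected {z. exp z \<in> Y}"
    and "S \<subseteq> Y" and S: "connected {z. exp z \<in> S}"
  shows "connected {x\<in>X. p x \<in> S}"
proof -
  define H where "H = {z. exp z \<in> Y}"
  obtain \<phi> where \<phi>: "continuous_on H \<phi>" "\<phi> \<in> H \<rightarrow> X" "\<And>z. z \<in> H \<Longrightarrow> p (\<phi> z) = exp z"
  proof (rule covering_space_lift [OF cov])
    show "simply_connected H" "locally path_connected H" using H by (auto simp: H_def)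
    show "exp \<in> H \<rightarrow> Y" by (auto simp: H_def)
  qed (auto intro!: continuous_intros)
  have surj: "\<exists>z\<in>H. \<phi> z = x" if x: "x \<in> X" for x
  proof -
    have pY: "p ` X = Y" "continuous_on X p"
      using cov by (auto simp: covering_space_imp_surjective covering_space_imp_continuous)
    then have "p x \<noteq> 0" using x \<open>0 \<notin> Y\<close> by auto
    \<comment> \<open>The logarithm only shows that \<open>H\<close> is nonempty:
      \<open>\<phi>\<close> may send it to another point of the fibre of \<open>x\<close>. The right
      preimage is found by lifting a path that ends at \<open>x\<close>.\<close>
    then have "Ln (p x) \<in> H" using x pY(1) by (auto simp: H_def)
    then obtain z0 where z0: "z0 \<in> H" by blast
    obtain g where g: "path g" "path_image g \<subseteq> X" "pathstart g = \<phi> z0" "pathfinish g = x"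
      using X x \<phi>(2) z0 unfolding path_connected_def by blast
    have pg: "path (p \<circ> g)" "path_image (p \<circ> g) \<subseteq> Y"
      using g pY by (auto intro: path_continuous_image continuous_on_subset simp: path_image_compose)
    obtain h where h: "path h" "pathstart h = z0" "\<And>t. t \<in> {0..1} \<Longrightarrow> exp (h t) = (p \<circ> g) t"
    proof (rule covering_space_lift_path_strong [OF covering_space_exp_punctured_plane _ pg(1)])
      show "path_image (p \<circ> g) \<subseteq> - {0}" using pg(2) \<open>0 \<notin> Y\<close> by auto
      show "pathstart (p \<circ> g) = exp z0"
        using g \<phi>(3) z0 by (simp add: pathstart_compose)
    qed auto
    have hH: "h t \<in> H" if "t \<in> {0..1}" for t
      using h(3)[OF that] pg(2) that by (auto simp: H_def path_image_def)
    \<comment> \<open>Both \<open>\<phi> \<circ> h\<close> and \<open>g\<close> lift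
      \<open>p \<circ> g\<close> through \<open>p\<close> from the same initial point.\<close>
    have "\<phi> (h 1) = g 1"
    proof (rule covering_space_lift_unique [OF cov, of "\<lambda>t. \<phi> (h t)" 0 g "{0..1}" "p \<circ> g"])
      show "\<phi> (h 0) = g 0" using g(3) h(2) by (simp add: pathstart_def)
      show "continuous_on {0..1} (\<lambda>t. \<phi> (h t))"
        using h(1) hH unfolding path_def
        by (intro continuous_on_compose2 [OF \<phi>(1)]) auto
      show "continuous_on {0..1} (p \<circ> g)" using pg by (simp add: path_def)
      show "continuous_on {0..1} g" using g by (simp add: path_def)
      show "p \<circ> g \<in> {0..1} \<rightarrow> Y" using pg(2) by (auto simp: path_image_def)
      show "(\<lambda>t. \<phi> (h t)) \<in> {0..1} \<rightarrow> X" using hH \<phi>(2) by auto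
      show "g \<in> {0..1} \<rightarrow> X" using g(2) by (auto simp: path_image_def)
    qed (use hH \<phi>(3) h(3) in auto)
    then show ?thesis using g(4) hH[of 1] by (auto simp: pathfinish_def)
  qed
  have "{x\<in>X. p x \<in> S} = \<phi> ` {z. exp z \<in> S}"
    using surj \<phi>(2,3) \<open>S \<subseteq> Y\<close> by (fastforce simp: H_def)
  moreover have "continuous_on {z. exp z \<in> S} \<phi>"
    using \<open>S \<subseteq> Y\<close> by (intro continuous_on_subset [OF \<phi>(1)]) (auto simp: H_def)
  ultimately show ?thesis using S by (simp add: connected_continuous_image)
qed

section \<open>Restriction and composition of proper maps, and connectedness criteria\<close>

lemma proper_into_closedin_subset:
  assumes "proper_into X Y f" "closedin (top_of_set X) C"
  shows "proper_into C Y f"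
proof -
  obtain D where D: "closed D" "C = X \<inter> D" using assms(2) by (auto simp: closedin_closed)
  have "compact {x\<in>C. f x \<in> K}" if "compact K" "K \<subseteq> Y" for K
  proof -
    have "{x\<in>C. f x \<in> K} = D \<inter> {x\<in>X. f x \<in> K}" using D by auto
    then show ?thesis
      using D(1) proper_intoD [OF assms(1) that] by (simp add: closed_Int_compact)
  qed
  then show ?thesis using assms(1) D by (auto simp: proper_into_def)
qed

lemma proper_into_preimage:
  assumes "proper_into X Y f" "Z \<subseteq> Y"
  shows "proper_into {x\<in>X. f x \<in> Z} Z f"
proof -
  have "{x \<in> {x\<in>X. f x \<in> Z}. f x \<in> K} = {x\<in>X. f x \<in> K}" if "K \<subseteq> Z" for K
    using that by auto
  then show ?thesis using assms by (auto simp: proper_into_def)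
qed

lemma proper_into_homeomorphism_compose:
  assumes "proper_into X Y f" and "homeomorphism Y Z h k"
  shows "proper_into X Z (\<lambda>x. h (f x))"
proof -
  have fY: "f x \<in> Y" if "x \<in> X" for x using assms(1) that by (auto simp: proper_into_def)
  have "compact {x\<in>X. h (f x) \<in> K}" if K: "compact K" "K \<subseteq> Z" for K
  proof -
    have "{x\<in>X. h (f x) \<in> K} = {x\<in>X. f x \<in> k ` K}"
    proof -
      have "h (f x) \<in> K \<longleftrightarrow> f x \<in> k ` K" if "x \<in> X" for x
        using homeomorphism_apply1 [OF assms(2) fY [OF that]] homeomorphism_apply2 [OF assms(2)] K(2)
        by (metis image_iff subsetD)
      then show ?thesis by auto
    qed
    moreover have "compact (k ` K)"
      using homeomorphism_cont2 [OF assms(2)] K by (metis compact_continuous_image continuous_on_subset)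
    moreover have "k ` K \<subseteq> Y"
      using homeomorphism_image2 [OF assms(2)] K(2) by blast
    ultimately show ?thesis using proper_intoD [OF assms(1)] by simp
  qed
  then show ?thesis using fY assms(2) by (auto simp: proper_into_def homeomorphism_def)
qed

text \<open>The inclusion of \<open>X\<close> into \<open>A\<close> is itself proper: the part of
  \<open>X\<close> in a compact \<open>K\<close> is cut out of the compact part of \<open>X\<close>
  lying over the image of \<open>K\<close>. This supplies the closed half of a clopen
  argument.\<close>

lemma proper_into_imp_closedin:
  fixes f :: "'a::heine_borel \<Rightarrow> 'b::heine_borel"
  assumes "proper_into X Y f" "X \<subseteq> A" "continuous_on A f" "f ` A \<subseteq> Y"
  shows "closedin (top_of_set A) X"
proof -
  have "closedin (top_of_set A) (id ` X)"
  proof (rule proper_map)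
    fix K assume K: "K \<subseteq> A" "compact K"
    have "compact (f ` K)" "f ` K \<subseteq> Y"
      using K assms by (auto intro!: compact_continuous_image intro: continuous_on_subset)
    then have "compact ({x\<in>X. f x \<in> f ` K} \<inter> K)"
      using K proper_intoD [OF assms(1)] by (intro compact_Int)
    moreover have "{x\<in>X. f x \<in> f ` K} \<inter> K = X \<inter> id -` K" by auto
    ultimately show "compact (X \<inter> id -` K)" by simp
  qed (use assms in auto)
  then show ?thesis by simp
qed

lemma proper_into_open_image_onto:
  fixes f :: "'a::heine_borel \<Rightarrow> 'b::heine_borel"
  assumes "proper_into X Y f" "X \<noteq> {}" "open (f ` X)" "connected Y"
  shows "f ` X = Y"
proof -
  have "closedin (top_of_set Y) (f ` X)"
    using assms(1) by (rule proper_into_closedin_image) simp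
  moreover have "openin (top_of_set Y) (f ` X)"
    using assms(1,3) by (auto simp: proper_into_def intro: open_subset)
  ultimately show ?thesis
    using assms(2,4) by (auto simp: connected_clopen)
qed

text \<open>Every point is joined within its component to a point of \<open>S\<close>, and
  \<open>S\<close> joins these points to each other.\<close>

lemma connected_if_components_meet:
  assumes "connected S" "S \<subseteq> W" and "\<And>C. C \<in> components W \<Longrightarrow> C \<inter> S \<noteq> {}"
  shows "connected W"
proof (unfold connected_iff_connected_component, intro ballI)
  have meet: "\<exists>s\<in>S. connected_component W z s" if "z \<in> W" for z
    using assms(3) [OF componentsI [OF that]] by auto
  fix x y assume "x \<in> W" "y \<in> W"
  then obtain s t where "s \<in> S" "connected_component W x s" "t \<in> S" "connected_component W y t"
    using meet by meson
  moreover from this have "connected_component W s t"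
    using assms(1,2) by (auto simp: connected_component_def)
  ultimately show "connected_component W x y"
    by (meson connected_component_sym connected_component_trans)
qed

section \<open>Polynomials as locally injective, open and proper maps\<close>

lemma poly_locally_injective:
  fixes F :: "complex poly"
  assumes "poly (pderiv F) z \<noteq> 0" "open X" "z \<in> X"
  shows "\<exists>N. open N \<and> z \<in> N \<and> N \<subseteq> X \<and> inj_on (poly F) N"
proof -
  have "deriv (poly F) z \<noteq> 0"
    using assms(1) DERIV_imp_deriv [OF poly_DERIV] by metis
  moreover have "poly F holomorphic_on X" by (intro holomorphic_intros)
  ultimately obtain r where "r > 0" "ball z r \<subseteq> X" "inj_on (poly F) (ball z r)"
    using has_complex_derivative_locally_injective assms(2,3) by metis
  then show ?thesis by (intro exI [of _ "ball z r"]) auto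
qed

lemma finite_poly_fibre:
  fixes F :: "complex poly"
  assumes "degree F > 0"
  shows "finite {z. poly F z = w}"
proof -
  have "F - [:w:] \<noteq> 0"
    using assms by (metis degree_pCons_0 eq_iff_diff_eq_0 less_irrefl)
  then have "finite {z. poly (F - [:w:]) z = 0}" by (rule poly_roots_finite)
  then show ?thesis by simp
qed

lemma poly_open_image:
  fixes F :: "complex poly"
  assumes "degree F > 0" "open X"
  shows "open (poly F ` X)"
proof (rule open_mapping_thm [of _ UNIV])
  show "\<not> poly F constant_on UNIV"
  proof
    assume "poly F constant_on UNIV"
    then obtain w where "{z. poly F z = w} = UNIV" by (auto simp: constant_on_def)
    then show False
      using finite_poly_fibre [OF assms(1), of w] infinite_UNIV_char_0 by metis
  qed
qed (use assms in \<open>auto intro!: holomorphic_intros\<close>)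

lemma poly_proper_onto:
  fixes F :: "complex poly"
  assumes "degree F > 0" "open X" "X \<noteq> {}" "connected Y" "proper_into X Y (poly F)"
  shows "poly F ` X = Y"
  using assms by (intro proper_into_open_image_onto poly_open_image)

text \<open>Growth at infinity bounds the preimage of a bounded set, and continuity closes
  it.\<close>

lemma proper_into_poly:
  fixes F :: "complex poly"
  assumes "degree F > 0"
  shows "proper_into UNIV UNIV (poly F)"
proof -
  have "compact {z. poly F z \<in> K}" if "compact K" for K
  proof -
    obtain B where B: "\<And>w. w \<in> K \<Longrightarrow> norm w \<le> B"
      using compact_imp_bounded [OF \<open>compact K\<close>] by (auto simp: bounded_iff)
    have "eventually (\<lambda>z. norm (poly F z) \<ge> B + 1) at_infinity"
      using filterlim_poly_at_infinity [OF assms]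
      by (metis filterlim_at_infinity_conv_norm_at_top filterlim_at_top)
    then obtain b where b: "\<And>z. norm z \<ge> b \<Longrightarrow> norm (poly F z) \<ge> B + 1"
      by (auto simp: eventually_at_infinity)
    have "norm z \<le> b" if "poly F z \<in> K" for z
      using B [OF that] b [of z] by linarith
    then have "bounded {z. poly F z \<in> K}" by (auto simp: bounded_iff)
    moreover have "closed (poly F -` K)"
      using compact_imp_closed [OF \<open>compact K\<close>]
      by (intro continuous_closed_vimage) (auto intro: continuous_intros)
    ultimately show ?thesis by (simp add: compact_eq_bounded_closed vimage_def)
  qed
  then show ?thesis by (auto simp: proper_into_def)
qed

section \<open>Preimages of planar domains under polynomials\<close>

text \<open>After uniformizing \<^term>\<open>V\<close> to the disc with \<^term>\<open>a\<close> at the centre, preimages of small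
  punctured discs are connected; they shrink to the finite fibre over \<^term>\<open>a\<close>.\<close>

lemma single_branch_value_imp_single_preimage:
  fixes F :: "complex poly"
  assumes deg: "degree F > 0" and C: "open C" "connected C" "C \<noteq> {}"
    and V: "open V" "simply_connected V" and pr: "proper_into C V (poly F)" and "a \<in> V"
    and crit: "\<And>z. z \<in> C \<Longrightarrow> poly (pderiv F) z = 0 \<Longrightarrow> poly F z = a"
  shows "\<exists>c. {z\<in>C. poly F z = a} = {c}"
proof -
  obtain g g' where g: "homeomorphism V (ball (0::complex) 1) g g'"
    using simply_connected_eq_homeomorphic_to_disc [OF V(1)] V(2) \<open>a \<in> V\<close>
    by (auto simp: homeomorphic_def)
  have ga: "g a \<in> ball 0 1" using g \<open>a \<in> V\<close> by (auto simp: homeomorphism_def)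
  \<comment> \<open>Any homeomorphism that moves \<open>g a\<close> to the centre will do, since
    only the topology of the disc matters from here on. The index set \<open>{()}\<close> encodes
    the single point to be moved.\<close>
  obtain m m' :: "complex \<Rightarrow> complex" where m: "homeomorphism (ball (0::complex) 1) (ball 0 1) m m'" "m (g a) = 0"
  proof (rule homeomorphism_moving_points_exists
      [of "ball (0::complex) 1" "ball 0 1" "{()}" "\<lambda>_. g a" "\<lambda>_. 0"])
    show "ball (0::complex) 1 \<subseteq> affine hull ball 0 1" by (rule hull_subset)
    fix f f' :: "complex \<Rightarrow> complex"
    assume "homeomorphism (ball 0 1) (ball 0 1) f f'" "\<And>i. i \<in> {()} \<Longrightarrow> f (g a) = 0"
    then show thesis using that by simp
  qed (use ga in auto)
  define h where "h = m \<circ> g"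
  define k where "k = g' \<circ> m'"
  have hk: "homeomorphism V (ball 0 1) h k"
    unfolding h_def k_def by (rule homeomorphism_compose [OF g m(1)])
  have ha: "h a = 0" using m(2) by (simp add: h_def)
  have h0: "h w = 0 \<longleftrightarrow> w = a" if "w \<in> V" for w
    using hk ha that \<open>a \<in> V\<close> by (metis homeomorphism_apply1)
  have FV: "poly F z \<in> V" if "z \<in> C" for z using pr that by (auto simp: proper_into_def)
  define p where "p z = h (poly F z)" for z
  have contp: "continuous_on C p"
    unfolding p_def
    by (rule continuous_on_compose2 [of V h])
       (use hk FV in \<open>auto simp: homeomorphism_def intro: continuous_intros\<close>)
  have pp: "proper_into C (ball 0 1) p"
    unfolding p_def by (rule proper_into_homeomorphism_compose [OF pr hk])
  have "connected V" using V(2) by (rule simply_connected_imp_connected)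
  then have onto: "poly F ` C = V" using deg C pr by (intro poly_proper_onto)
  define Y where "Y = ball (0::complex) 1 - {0}"
  define X where "X = {z\<in>C. p z \<in> Y}"
  have X_eq: "X = C - {z. poly F z = a}"
    using FV h0 pp by (auto simp: X_def Y_def p_def proper_into_def)
  have finX: "finite {z. poly F z = a}" by (rule finite_poly_fibre [OF deg])
  have oX: "open X"
    unfolding X_eq using C(1) finX by (intro open_Diff finite_imp_closed)
  have "connected X"
    unfolding X_eq using C finX by (intro connected_open_delete_finite) auto
  then have pcX: "path_connected X" using oX by (simp add: connected_open_path_connected)
  \<comment> \<open>The critical points in \<open>C\<close> lie over \<open>a\<close>, hence outside
    \<open>X\<close>, so \<open>p\<close> is locally injective on \<open>X\<close>.\<close>
  have cov: "covering_space X p Y"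
  proof (rule proper_into_local_injection_covering_space)
    show "proper_into X Y p"
      unfolding X_def by (rule proper_into_preimage [OF pp]) (auto simp: Y_def)
    have "p ` C = h ` poly F ` C" by (simp add: p_def image_image)
    then have "Y \<subseteq> p ` C" using onto hk by (auto simp: Y_def homeomorphism_def)
    then show "p ` X = Y" unfolding X_def by blast
    show "continuous_on X p" using contp by (rule continuous_on_subset) (auto simp: X_def)
    fix x assume x: "x \<in> X"
    then have "poly (pderiv F) x \<noteq> 0" using crit by (auto simp: X_eq)
    then obtain N where N: "open N" "x \<in> N" "N \<subseteq> X" "inj_on (poly F) N"
      using poly_locally_injective oX x by metis
    have "inj_on p N"
    proof (rule inj_onI)
      fix u v assume "u \<in> N" "v \<in> N" "p u = p v"
      then show "u = v"
        using N hk FV by (metis (no_types, lifting) DiffD1 X_eq homeomorphism_apply1 inj_onD p_def subsetD)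
    qed
    then show "\<exists>N. open N \<and> x \<in> N \<and> N \<subseteq> X \<and> inj_on p N" using N by blast
  qed (use oX in \<open>auto simp: Y_def open_delete\<close>)
  define L where "L r = {z\<in>C. norm (p z) \<le> r}" for r
  have connL: "connected (L r)" if r: "0 < r" "r < 1" for r
  proof -
    define S where "S = {w::complex. w \<noteq> 0 \<and> norm w \<le> r}"
    \<comment> \<open>The logarithm turns the punctured disc into a left half-plane.\<close>
    have conv: "convex {z::complex. exp z \<in> Y}"
    proof -
      have "{z::complex. exp z \<in> Y} = {z. Re z < 0}" by (auto simp: Y_def)
      then show ?thesis by (simp add: convex_halfspace_Re_lt)
    qed
    have A: "connected {z\<in>X. p z \<in> S}"
    proof (rule covering_space_connected_preimage [OF cov])
      have "{z. exp z \<in> S} = {z. Re z \<le> ln r}"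
        using r by (auto simp: S_def ln_ge_iff simp flip: exp_le_cancel_iff[of _ "ln r"])
      then show "connected {z. exp z \<in> S}"
        by (simp add: convex_connected convex_halfspace_Re_le)
    qed (use r conv pcX in \<open>auto simp: Y_def S_def convex_imp_simply_connected convex_imp_locally_path_connected\<close>)
    \<comment> \<open>\<open>S\<close> omits the centre. Adding the fibre over it preserves
      connectedness because its points are limits of the rest.\<close>
    show ?thesis
    proof (rule connected_intermediate_closure [OF A])
      show "{z\<in>X. p z \<in> S} \<subseteq> L r" by (auto simp: X_def L_def S_def)
      show "L r \<subseteq> closure {z\<in>X. p z \<in> S}"
      proof
        fix x assume x: "x \<in> L r"
        show "x \<in> closure {z\<in>X. p z \<in> S}"
        proof (cases "p x = 0")
          case False
          then have "x \<in> {z\<in>X. p z \<in> S}"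
            using x r by (auto simp: L_def X_def S_def Y_def)
          then show ?thesis by (rule subsetD [OF closure_subset])
        next
          case True
          define W where "W = C \<inter> p -` ball 0 r"
          have "open W" unfolding W_def using contp C(1) by (intro continuous_open_preimage) auto
          moreover have "x \<in> W" using x True r by (auto simp: W_def L_def)
          moreover have "closure (- {z. poly F z = a}) = UNIV"
            using finX by (simp add: closure_complement empty_interior_finite)
          ultimately have "x \<in> closure (W \<inter> - {z. poly F z = a})"
            using open_Int_closure_subset [of W "- {z. poly F z = a}"] by auto
          moreover have "W \<inter> - {z. poly F z = a} \<subseteq> {z\<in>X. p z \<in> S}"
            using h0 FV by (auto simp: W_def X_eq S_def p_def)
          ultimately show ?thesis by (meson closure_mono subsetD)
        qed
      qed
    qed
  qed
  \<comment> \<open>The offset 2 keeps the radius below 1 even at \<open>n = 0\<close>, so these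
    closed discs are compact in the open disc and properness applies.\<close>
  define R where "R n = L (1 / (real n + 2))" for n :: nat
  have "connected (\<Inter> (range R))"
  proof (rule connected_nest)
    fix n
    show "connected (R n)" unfolding R_def by (rule connL) auto
    have "R n = {z\<in>C. p z \<in> cball 0 (1 / (real n + 2))}" by (auto simp: R_def L_def)
    moreover have "cball (0::complex) (1 / (real n + 2)) \<subseteq> ball 0 1"
    proof
      fix w :: complex assume "w \<in> cball 0 (1 / (real n + 2))"
      then have "norm w \<le> 1 / (real n + 2)" by simp
      also have "\<dots> < 1" by simp
      finally show "w \<in> ball 0 1" by simp
    qed
    ultimately show "compact (R n)" by (metis proper_intoD [OF pp compact_cball])
  next
    fix m n :: nat assume "m \<le> n"
    then have "1 / (real n + 2) \<le> 1 / (real m + 2)" by (auto simp: field_simps)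
    then show "R n \<subseteq> R m" by (auto simp: R_def L_def)
  qed
  moreover have "\<Inter> (range R) = {z\<in>C. poly F z = a}"
  proof -
    have "p z = 0" if "\<And>n::nat. norm (p z) \<le> 1 / (real n + 2)" for z
    proof (rule ccontr)
      assume "p z \<noteq> 0"
      then obtain n :: nat where "inverse (real (Suc n)) < norm (p z)"
        using reals_Archimedean by (metis zero_less_norm_iff)
      moreover have "1 / (real n + 2) \<le> inverse (real (Suc n))" by (simp add: field_simps)
      ultimately show False using that [of n] by linarith
    qed
    then have "(\<forall>n::nat. norm (p z) \<le> 1 / (real n + 2)) \<longleftrightarrow> p z = 0" for z by auto
    moreover have "p z = 0 \<longleftrightarrow> poly F z = a" if "z \<in> C" for z
      unfolding p_def by (rule h0 [OF FV [OF that]])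
    ultimately show ?thesis by (auto simp: R_def L_def)
  qed
  ultimately have "connected {z\<in>C. poly F z = a}" by simp
  moreover have "finite {z\<in>C. poly F z = a}"
    using finX by (rule rev_finite_subset) auto
  moreover have "{z\<in>C. poly F z = a} \<noteq> {}" using onto \<open>a \<in> V\<close> by blast
  ultimately show ?thesis using connected_finite_iff_sing by blast
qed

text \<open>A homeomorphism supported in \<^term>\<open>V\<close> moves all critical values into a small disc, outside of
  which the polynomial becomes a covering. The preimage of a slightly larger circle is then connected,
  and it meets every component of the preimage of \<^term>\<open>V\<close>.\<close>

lemma connected_poly_preimage:
  fixes F :: "complex poly"
  assumes deg: "degree F > 0" and V: "open V" "connected V"
    and crit: "\<And>z. poly (pderiv F) z = 0 \<Longrightarrow> poly F z \<in> V"
  shows "connected {z. poly F z \<in> V}"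
proof (cases "V = {}")
  case False
  then obtain p r where "r > 0" and r: "cball p r \<subseteq> V"
    using V(1) by (metis all_not_in_conv open_contains_cball)
  \<comment> \<open>The critical values will be moved inside radius \<open>e\<close>, which leaves
    the circle of radius \<open>r\<close> in the region that gets covered.\<close>
  define e where "e = r / 2"
  have e: "0 < e" "e < r" using \<open>r > 0\<close> by (auto simp: e_def)
  define K where "K = poly F ` {z. poly (pderiv F) z = 0}"
  have "pderiv F \<noteq> 0" using deg by (simp add: pderiv_eq_0_iff)
  then have finK: "finite K" unfolding K_def by (intro finite_imageI poly_roots_finite)
  have KV: "K \<subseteq> V" using crit by (auto simp: K_def)
  have "infinite (ball p e)"
    using e uncountable_ball countable_finite by metis
  \<comment> \<open>A homeomorphism is injective, so distinct critical values need distinct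
    targets.\<close>
  then obtain B where B: "finite B" "card B = card K" "B \<subseteq> ball p e"
    using infinite_arbitrarily_large by metis
  then obtain y where y: "y ` K \<subseteq> B" "inj_on y K"
    using card_le_inj [OF finK] by (metis order_refl)
  have beV: "ball p e \<subseteq> V"
    using r e by (auto simp: subset_iff)
  \<comment> \<open>Since the support lies in \<open>V\<close>, \<open>h\<close> preserves
    \<open>V\<close>, and following \<open>F\<close> by \<open>h\<close> does not change the
    preimage of \<open>V\<close>.\<close>
  obtain h k :: "complex \<Rightarrow> complex" where hk: "homeomorphism UNIV UNIV h k"
    and hy: "\<And>c. c \<in> K \<Longrightarrow> h c = y c" and supp: "{x. \<not> (h x = x \<and> k x = x)} \<subseteq> V"
  proof (rule homeomorphism_moving_points_exists [of V UNIV K "\<lambda>c. c" y])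
    show "c \<in> V \<and> y c \<in> V" if "c \<in> K" for c
      using that KV y(1) B(3) beV by blast
    show "pairwise (\<lambda>i j. i \<noteq> j \<and> y i \<noteq> y j) K"
      using y(2) by (auto simp: pairwise_def inj_on_def)
    show "UNIV \<subseteq> affine hull V" using affine_hull_open [OF V(1) False] by simp
    fix f f' :: "complex \<Rightarrow> complex"
    assume "homeomorphism UNIV UNIV f f'" "\<And>c. c \<in> K \<Longrightarrow> f c = y c" "{x. \<not> (f x = x \<and> f' x = x)} \<subseteq> V"
    then show thesis by (rule that)
  qed (use V finK in auto)
  have hV: "w \<in> V" if "h w \<in> V" for w
    using that supp by (cases "w \<in> V") force+
  have hVV: "h w \<in> V" if "w \<in> V" for w
  proof (rule ccontr)
    assume "h w \<notin> V"
    then have "k (h w) = h w" using supp by blast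
    then have "h w = w" using hk by (simp add: homeomorphism_def)
    then show False using \<open>h w \<notin> V\<close> that by simp
  qed
  \<comment> \<open>The translation centres the disc at the origin, so that lifting through
    \<open>exp\<close> applies to its exterior.\<close>
  define g where "g w = h w - p" for w
  have gk: "homeomorphism UNIV UNIV g (\<lambda>w. k (w + p))"
  proof (rule homeomorphismI)
    show "continuous_on UNIV g"
      using homeomorphism_cont1 [OF hk] unfolding g_def by (intro continuous_intros)
    show "continuous_on UNIV (\<lambda>w. k (w + p))"
      by (rule continuous_on_compose2 [OF homeomorphism_cont2 [OF hk]]) (auto intro!: continuous_intros)
  qed (use hk in \<open>auto simp: g_def homeomorphism_def\<close>)
  have injg: "g u = g v \<longleftrightarrow> u = v" for u v
    using gk by (metis UNIV_I homeomorphism_apply1)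
  define q where "q z = g (poly F z)" for z
  have contq: "continuous_on A q" for A
    unfolding q_def
    by (rule continuous_on_compose2 [of UNIV g])
       (use gk in \<open>auto simp: homeomorphism_def intro: continuous_intros\<close>)
  have pq: "proper_into UNIV UNIV q"
    unfolding q_def by (rule proper_into_homeomorphism_compose [OF proper_into_poly [OF deg] gk])
  define Y where "Y = - cball (0::complex) e"
  define X where "X = {z. q z \<in> Y}"
  have pX: "proper_into X Y q"
    using proper_into_preimage [OF pq, of Y] by (simp add: X_def)
  have Y: "open Y" "connected Y" "\<not> bounded Y"
    unfolding Y_def using e
    by (auto simp: connected_complement_bounded_convex cobounded_imp_unbounded)
  have oX: "open X"
    unfolding X_def using contq Y(1) by (metis continuous_on_open_vimage open_UNIV inf_top.right_neutral vimage_def)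
  \<comment> \<open>Stated for relatively closed open pieces so that it covers both \<open>X\<close>
    and its components.\<close>
  have onto: "q ` C = Y" if "C \<noteq> {}" "open C" "closedin (top_of_set X) C" for C
  proof (rule proper_into_open_image_onto)
    show "proper_into C Y q" using pX that(3) by (rule proper_into_closedin_subset)
    have "open (g ` poly F ` C)"
      using homeomorphism_imp_open_map [OF gk] poly_open_image [OF deg \<open>open C\<close>] by auto
    then show "open (q ` C)" by (simp add: q_def image_image)
  qed (use that Y in auto)
  have bX: "bounded (- X)"
  proof -
    have "- X = {z\<in>UNIV. q z \<in> cball 0 e}" by (auto simp: X_def Y_def)
    then show ?thesis using proper_intoD [OF pq, of "cball 0 e"] by (simp add: compact_imp_bounded)
  qed
  \<comment> \<open>A bounded component would have bounded image, yet it maps onto the unbounded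
    \<open>Y\<close>. As the complement of \<open>X\<close> is bounded, only one component is
    unbounded.\<close>
  have "connected X"
  proof (unfold connected_iff_connected_component_eq, intro ballI)
    fix u v assume "u \<in> X" "v \<in> X"
    have "\<not> bounded (connected_component_set X x)" if "x \<in> X" for x
    proof
      let ?C = "connected_component_set X x"
      assume "bounded ?C"
      then have "bounded (q ` closure ?C)"
        by (intro compact_imp_bounded compact_continuous_image contq) (simp add: compact_closure)
      moreover have "q ` ?C = Y"
        using that oX
        by (intro onto closedin_connected_component open_connected_component)
           (simp_all add: connected_component_eq_empty del: Collect_empty_eq)
      ultimately show False
        using Y(3) by (metis bounded_subset closure_subset image_mono)
    qed
    with bX show "connected_component_set X u = connected_component_set X v"
      using \<open>u \<in> X\<close> \<open>v \<in> X\<close>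
      by (intro cobounded_unique_unbounded_component) auto
  qed
  then have pcX: "path_connected X" using oX by (simp add: connected_open_path_connected)
  have "X \<noteq> {}"
    using bX not_bounded_UNIV by auto
  have cov: "covering_space X q Y"
  proof (rule proper_into_local_injection_covering_space)
    show "q ` X = Y" using \<open>X \<noteq> {}\<close> oX by (intro onto) auto
    fix x assume x: "x \<in> X"
    have "poly (pderiv F) x \<noteq> 0"
    proof
      assume "poly (pderiv F) x = 0"
      then have "poly F x \<in> K" by (auto simp: K_def)
      then have "h (poly F x) \<in> ball p e" using hy y(1) B(3) by (metis image_subset_iff subsetD)
      then show False
        using x by (simp add: X_def Y_def q_def g_def dist_norm norm_minus_commute)
    qed
    then obtain N where N: "open N" "x \<in> N" "N \<subseteq> X" "inj_on (poly F) N"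
      using poly_locally_injective oX x by metis
    then have "inj_on q N" by (auto simp: inj_on_def q_def injg)
    then show "\<exists>N. open N \<and> x \<in> N \<and> N \<subseteq> X \<and> inj_on q N" using N by blast
  qed (use oX Y pX contq in auto)
  \<comment> \<open>The logarithm of this circle is a vertical line and that of \<open>Y\<close> a
    right half-plane, both convex.\<close>
  define M where "M = {z\<in>X. q z \<in> sphere 0 r}"
  have "connected M"
    unfolding M_def
  proof (rule covering_space_connected_preimage [OF cov])
    have "{z. exp z \<in> sphere 0 r} = {z. Re z \<le> ln r} \<inter> {z. Re z \<ge> ln r}"
      using \<open>r > 0\<close> by (auto simp flip: ln_unique)
    then have "convex {z::complex. exp z \<in> sphere 0 r}"
      by (simp only: convex_Int convex_halfspace_Re_ge convex_halfspace_Re_le)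
    then show "connected {z::complex. exp z \<in> sphere 0 r}" by (rule convex_connected)
    have "e < exp x \<longleftrightarrow> ln e < x" for x
      using e(1) by (metis exp_less_cancel_iff exp_ln)
    then have "{z::complex. exp z \<in> Y} = {z. Re z > ln e}"
      by (auto simp: Y_def not_le)
    then have "convex {z::complex. exp z \<in> Y}" by (simp add: convex_halfspace_Re_gt)
    then show "simply_connected {z::complex. exp z \<in> Y}" "locally path_connected {z::complex. exp z \<in> Y}"
      by (auto simp: convex_imp_simply_connected convex_imp_locally_path_connected)
  qed (use e pcX in \<open>auto simp: Y_def\<close>)
  then show ?thesis
  proof (rule connected_if_components_meet)
    show "M \<subseteq> {z. poly F z \<in> V}"
    proof
      fix z assume "z \<in> M"
      then have "h (poly F z) \<in> cball p r"
        by (simp add: M_def q_def g_def dist_norm norm_minus_commute)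
      then show "z \<in> {z. poly F z \<in> V}" using r hV by auto
    qed
    fix C assume C: "C \<in> components {z. poly F z \<in> V}"
    have pV: "proper_into {z. poly F z \<in> V} V (poly F)"
      using proper_into_preimage [OF proper_into_poly [OF deg], of V] by simp
    have "open {z. poly F z \<in> V}"
      using continuous_open_vimage [of V "poly F"] V(1) by (simp add: vimage_def continuous_at_imp_continuous_on)
    \<comment> \<open>A component is open and still proper over \<open>V\<close>, so it covers all
      of \<open>V\<close>, including a point that \<open>h\<close> sends to the circle.\<close>
    then have "poly F ` C = V"
      using deg C V proper_into_closedin_subset [OF pV closedin_component [OF C]]
      by (intro poly_proper_onto) (use in_components_nonempty [OF C] in \<open>auto intro: open_components\<close>)
    moreover obtain w where w: "h w = p + of_real r"
      using hk by (metis UNIV_I homeomorphism_def rangeE)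
    moreover have "p + of_real r \<in> V"
      using r \<open>r > 0\<close> by (auto simp: dist_norm)
    ultimately obtain z where "z \<in> C" "poly F z = w"
      using hV by (metis imageE)
    then have "z \<in> C \<inter> M"
      using w e \<open>r > 0\<close> by (simp add: M_def X_def Y_def q_def g_def)
    then show "C \<inter> M \<noteq> {}" by blast
  qed
qed auto

section \<open>Critical points and values of iterates\<close>

lemma poly_poly_iter: "poly (poly_iter P n) = poly P ^^ n"
  by (induction n) (auto simp: poly_iter_def poly_pcompose fun_eq_iff)

lemma degree_poly_iter: "degree (poly_iter P n) = degree P ^ n"
  by (induction n) (auto simp: poly_iter_def degree_pcompose)

text \<open>By the chain rule, the derivative of the iterate is the product of the values of
  \<open>pderiv P\<close> at the first \<open>n\<close> points of the orbit.\<close>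

lemma critical_point_poly_iter:
  assumes "poly (pderiv (poly_iter P n)) z = 0"
  shows "\<exists>j<n. (poly P ^^ j) z \<in> crit_points P"
  using assms
proof (induction n)
  case 0
  then show ?case by (simp add: poly_iter_def pderiv_pCons)
next
  case (Suc n)
  have "poly_iter P (Suc n) = pcompose P (poly_iter P n)" by (simp add: poly_iter_def)
  then have "poly (pderiv P) ((poly P ^^ n) z) = 0 \<or> poly (pderiv (poly_iter P n)) z = 0"
    using Suc.prems by (simp add: pderiv_pcompose poly_pcompose poly_poly_iter)
  then show ?case
    using Suc.IH by (auto simp: crit_points_def less_Suc_eq)
qed

text \<open>The orbit of \<open>z\<close> meets a critical point of \<open>P\<close> at some time
  \<open>j < n\<close>, so at least one step remains, as \<open>postcritical_set\<close>
  requires.\<close>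

lemma critical_value_poly_iter:
  assumes "poly (pderiv (poly_iter P n)) z = 0"
  shows "poly (poly_iter P n) z \<in> postcritical_set P"
proof -
  obtain j where j: "j < n" "(poly P ^^ j) z \<in> crit_points P"
    using critical_point_poly_iter [OF assms] by blast
  have "(poly P ^^ n) z = (poly P ^^ (n - j)) ((poly P ^^ j) z)"
    using j(1) by (simp flip: funpow_add [THEN fun_cong, unfolded comp_def])
  then show ?thesis
    using j unfolding postcritical_set_def poly_poly_iter
    by (intro UN_I [of "n - j"] image_eqI) auto
qed

lemma postcritical_set_poly_iter:
  assumes "w \<in> postcritical_set P"
  shows "poly (poly_iter P n) w \<in> postcritical_set P"
proof -
  obtain m c where "m \<ge> 1" "c \<in> crit_points P" "w = (poly P ^^ m) c"
    using assms by (auto simp: postcritical_set_def)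
  then show ?thesis
    unfolding postcritical_set_def poly_poly_iter
    by (intro UN_I [of "n + m"] image_eqI [of _ _ c]) (auto simp: funpow_add)
qed

text \<open>The whole orbit of \<open>z\<close> is periodic, and by the chain rule it passes through
  a critical point of \<open>P\<close>.\<close>

lemma fixed_critical_point_poly_iter:
  assumes "poly (pderiv (poly_iter P n)) z = 0" "poly (poly_iter P n) z = z"
  shows "\<exists>c\<in>crit_points P. periodic_point P c"
proof -
  obtain j where j: "j < n" "(poly P ^^ j) z \<in> crit_points P"
    using critical_point_poly_iter [OF assms(1)] by blast
  have "(poly P ^^ n) ((poly P ^^ j) z) = (poly P ^^ j) ((poly P ^^ n) z)"
    by (metis add.commute comp_apply funpow_add)
  then have "(poly P ^^ n) ((poly P ^^ j) z) = (poly P ^^ j) z"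
    using assms(2) by (simp add: poly_poly_iter)
  then show ?thesis
    using j by (intro bexI [of _ "(poly P ^^ j) z"]) (auto simp: periodic_point_def intro!: exI [of _ n])
qed

section \<open>Multiplicities in fibres\<close>

text \<open>Used contrapositively: a fibre point of multiplicity at least 2 is critical.\<close>

lemma order_eq_1_if_pderiv_nonzero:
  fixes F :: "complex poly"
  assumes "poly (pderiv F) z \<noteq> 0" "poly F z = w"
  shows "order z (F - [:w:]) = 1"
proof -
  let ?G = "F - [:w:]"
  have G: "poly (pderiv ?G) z \<noteq> 0" using assms(1) by (simp add: pderiv_diff pderiv_pCons)
  then have "?G \<noteq> 0" by auto
  then show ?thesis
    using order_pderiv [of ?G z] order_0I [OF G] assms(2) by simp
qed

text \<open>The fundamental theorem of algebra, phrased with the sum of orders by which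
  \<open>polynomial_like\<close> counts its degree.\<close>

lemma sum_order_eq_degree:
  fixes p :: "complex poly"
  assumes "p \<noteq> 0"
  shows "(\<Sum>z\<in>{z. poly p z = 0}. order z p) = degree p"
proof -
  have "degree p = (\<Sum>z\<in>set_mset (proots p). count (proots p) z)"
    by (simp add: size_proots_complex flip: size_multiset_overloaded_eq)
  then show ?thesis using assms by simp
qed

section \<open>Polynomial-like maps and their filled Julia sets\<close>

text \<open>Iterated preimages of the closure of \<open>U\<close> form a decreasing sequence of
  nonempty compact sets.\<close>

lemma filled_julia_restr_nonempty:
  assumes pr: "proper_into U V (poly F)" and onto: "poly F ` U = V"
    and U: "compact (closure U)" "closure U \<subseteq> V" "U \<noteq> {}"
  shows "filled_julia_restr F U \<noteq> {}"
proof -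
  \<comment> \<open>\<open>T n\<close> holds the points whose iterates of index below
    \<open>n\<close> lie in \<open>U\<close> and whose \<open>n\<close>-th iterate lies in the
    closure. Starting from the closure keeps every stage compact.\<close>
  define T where "T n = ((\<lambda>A. {z\<in>U. poly F z \<in> A}) ^^ n) (closure U)" for n
  have T0: "T 0 = closure U" and TS: "T (Suc n) = {z\<in>U. poly F z \<in> T n}" for n
    by (auto simp: T_def)
  have dec: "T (Suc n) \<subseteq> T n" for n
  proof (induction n)
    case 0
    show ?case using closure_subset by (auto simp: T0 TS)
  next
    case (Suc n)
    then show ?case by (auto simp: TS)
  qed
  have TV: "T n \<subseteq> V" for n
    using lift_Suc_antimono_le [of T, OF dec, of 0 n] U(2) by (auto simp: T0)
  have "\<Inter> (range T) \<noteq> {}"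
  proof (rule compact_nest)
    fix n
    show "compact (T n)"
    proof (induction n)
      case (Suc n)
      then show ?case using proper_intoD [OF pr] TV by (simp add: TS)
    qed (use U T0 in auto)
    show "T n \<noteq> {}"
    proof (induction n)
      case (Suc n)
      then obtain w where "w \<in> T n" by blast
      moreover obtain z where "z \<in> U" "poly F z = w" using TV onto \<open>w \<in> T n\<close> by blast
      ultimately show ?case by (auto simp: TS)
    qed (use U T0 in auto)
  qed (use lift_Suc_antimono_le [of T, OF dec] in blast)
  then obtain z where z: "\<And>n. z \<in> T n" by blast
  \<comment> \<open>The index shifts by one because membership in \<open>T n\<close> places the
    \<open>n\<close>-th iterate only in the closure.\<close>
  have "(poly F ^^ n) x \<in> U" if "x \<in> T (Suc n)" for n x
    using that
  proof (induction n arbitrary: x)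
    case (Suc n)
    then have "poly F x \<in> T (Suc n)" by (simp add: TS)
    then show ?case using Suc.IH by (simp add: funpow_swap1)
  qed (simp add: TS)
  then have "z \<in> filled_julia_restr F U" using z by (simp add: filled_julia_restr_def)
  then show ?thesis by blast
qed

lemma jordan_domain_properties:
  assumes "jordan_domain U"
  shows "open U" "connected U" "simply_connected U" "U \<noteq> {}"
  using assms Jordan_inside_outside simply_connected_inside_simple_path
  unfolding jordan_domain_def by blast+

text \<open>Stated for one polynomial whose critical values lie in a forward invariant pair, so that
  iteration enters only when it is applied to \<open>poly_iter P n\<close>.\<close>

lemma polynomial_like_full_degree_or_fixed_critical_point:
  fixes F :: "complex poly"
  assumes deg: "degree F > 0" and like: "polynomial_like F U V \<delta>" and "\<delta> \<ge> 2"
    and conn: "connected (filled_julia_restr F U)"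
    and crit: "\<And>z. poly (pderiv F) z = 0 \<Longrightarrow> poly F z \<in> {a, b}"
    and inv: "poly F ` {a, b} \<subseteq> {a, b}"
  shows "\<delta> = degree F \<or> (\<exists>z. poly (pderiv F) z = 0 \<and> poly F z = z)"
proof -
  have U: "open U" "connected U" "simply_connected U" "U \<noteq> {}"
    and V: "open V" "connected V" "simply_connected V" "V \<noteq> {}"
    using like jordan_domain_properties by (auto simp: polynomial_like_def)
  have clU: "compact (closure U)" "closure U \<subseteq> V" "U \<subseteq> V"
    using like closure_subset by (auto simp: polynomial_like_def)
  have pr: "proper_into U V (poly F)"
    using like by (auto simp: polynomial_like_def proper_into_def)
  have sum: "(\<Sum>z\<in>{z\<in>U. poly F z = w}. order z (F - [:w:])) = \<delta>" if "w \<in> V" for w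
    using like that by (auto simp: polynomial_like_def)
  have FV: "poly F z \<in> V" if "z \<in> U" for z using pr that by (auto simp: proper_into_def)
  have onto: "poly F ` U = V" using deg U V pr by (intro poly_proper_onto)
  \<comment> \<open>A lone preimage carries the whole multiplicity
    \<open>\<delta> \<ge> 2\<close>.\<close>
  have ram: "poly (pderiv F) c = 0" "poly F c = w"
    if "{z\<in>U. poly F z = w} = {c}" "w \<in> V" for c w
  proof -
    show "poly F c = w" using that(1) by blast
    have "order c (F - [:w:]) = \<delta>" using sum [OF that(2)] by (simp add: that(1))
    then show "poly (pderiv F) c = 0"
      using order_eq_1_if_pderiv_nonzero [of F c w] \<open>poly F c = w\<close> \<open>\<delta> \<ge> 2\<close> by auto
  qed
  show ?thesis
  proof (cases "{a, b} \<subseteq> V")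
    case True
    let ?A = "{z. poly F z \<in> V}"
    have "connected ?A"
      using crit True by (intro connected_poly_preimage [OF deg V(1,2)]) blast
    \<comment> \<open>Together with openness this makes \<open>U\<close> clopen in the connected
      full preimage of \<open>V\<close>, hence equal to it.\<close>
    moreover have "closedin (top_of_set ?A) U"
      using FV by (intro proper_into_imp_closedin [OF pr]) (auto intro: continuous_intros)
    moreover have "openin (top_of_set ?A) U"
      using U(1) FV by (intro open_subset) auto
    ultimately have UA: "U = ?A" using U(4) by (auto simp: connected_clopen)
    obtain w where "w \<in> V" using V(4) by blast
    then have "{z\<in>U. poly F z = w} = {z. poly (F - [:w:]) z = 0}" by (auto simp: UA)
    moreover have "degree (F - [:w:]) = degree F"
      using deg by (simp add: degree_add_eq_left flip: add_uminus_conv_diff)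
    moreover from this have "F - [:w:] \<noteq> 0" using deg by (metis degree_0 less_irrefl)
    ultimately show ?thesis
      using sum [OF \<open>w \<in> V\<close>] sum_order_eq_degree [of "F - [:w:]"] by simp
  next
    case False
    \<comment> \<open>If neither \<open>a\<close> nor \<open>b\<close> lies in \<open>V\<close>, any
      point of \<open>V\<close> serves as \<open>s\<close>; its critical preimage later forces
      \<open>s \<in> {a, b}\<close>.\<close>
    have "\<exists>s\<in>V. {a, b} \<inter> V \<subseteq> {s}" using False V(4) by (cases "a \<in> V"; cases "b \<in> V") auto
    then obtain s where s: "s \<in> V" "{a, b} \<inter> V \<subseteq> {s}" by blast
    have crit_s: "poly F z = s" if "z \<in> U" "poly (pderiv F) z = 0" for z
      using crit [OF that(2)] FV [OF that(1)] s(2) by blast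
    obtain c where c: "{z\<in>U. poly F z = s} = {c}"
      using single_branch_value_imp_single_preimage [OF deg U(1,2,4) V(1,3) pr s(1) crit_s] by blast
    have "poly (pderiv F) c = 0" "poly F c = s" using ram [OF c s(1)] by auto
    then have "s \<in> {a, b}" using crit by blast
    have "s \<in> U"
    proof (rule ccontr)
      assume "s \<notin> U"
      let ?K = "filled_julia_restr F U"
      obtain k where k: "k \<in> ?K"
        using filled_julia_restr_nonempty [OF pr onto clU(1,2) U(4)] by blast
      define W where "W = {z\<in>U. poly F z \<in> U}"
      \<comment> \<open>Connectedness of the filled Julia set places all of it in this one
        component.\<close>
      define C where "C = connected_component_set W k"
      have KW: "?K \<subseteq> W"
      proof
        fix z assume "z \<in> ?K"
        then have "(poly F ^^ j) z \<in> U" for j by (simp add: filled_julia_restr_def)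
        from this [of 0] this [of 1] show "z \<in> W" by (simp add: W_def)
      qed
      then have KC: "?K \<subseteq> C"
        unfolding C_def using k conn by (intro connected_component_maximal)
      have kU: "k \<in> U" using k KW by (auto simp: W_def)
      have "open W"
        unfolding W_def using continuous_open_preimage [of U "poly F" U] U(1)
        by (simp add: vimage_def Int_def continuous_intros)
      then have C: "open C" "connected C" "C \<noteq> {}" "C \<subseteq> W" "closedin (top_of_set W) C"
        using k KC unfolding C_def
        by (auto simp: open_connected_component connected_component_subset closedin_connected_component)
      have "proper_into W U (poly F)"
        unfolding W_def using pr clU(3) by (rule proper_into_preimage)
      then have "proper_into C U (poly F)" using C(5) by (rule proper_into_closedin_subset)
      \<comment> \<open>This holds vacuously: \<open>C\<close> maps into \<open>U\<close>, which
        misses the only critical value \<open>s\<close>. Any point of \<open>U\<close>, here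
        \<open>k\<close>, may thus play the branch value.\<close>
      moreover have "poly F z = k" if "z \<in> C" "poly (pderiv F) z = 0" for z
        using crit_s [of z] that C(4) \<open>s \<notin> U\<close> by (auto simp: W_def)
      ultimately obtain c' where c': "{z\<in>C. poly F z = k} = {c'}"
        using single_branch_value_imp_single_preimage [OF deg C(1-3) U(1,3) _ kU] by blast
      have "z \<in> ?K" if "z \<in> U" "poly F z = k" for z
      proof -
        have "(poly F ^^ j) z \<in> U" for j
          using k that by (cases j) (auto simp: filled_julia_restr_def funpow_swap1)
        then show ?thesis by (simp add: filled_julia_restr_def)
      qed
      \<comment> \<open>Every preimage of \<open>k\<close> in \<open>U\<close> is in the filled
        Julia set and hence in \<open>C\<close>. So \<open>k\<close> has a single preimage in
        \<open>U\<close>, which is critical, although the critical value \<open>s\<close> is outside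
        \<open>U\<close>.\<close>
      then have "{z\<in>U. poly F z = k} = {z\<in>C. poly F z = k}"
        using KC C(4) by (auto simp: W_def)
      then have "poly (pderiv F) c' = 0" "poly F c' = k" "c' \<in> U"
        using ram [of k c'] c' kU clU(3) by auto
      then show False using crit_s [of c'] \<open>s \<notin> U\<close> kU by simp
    qed
    \<comment> \<open>As \<open>s \<in> U\<close>, its image is in \<open>V\<close> and in
      \<open>{a, b}\<close>, where only \<open>s\<close> is available.\<close>
    then have "poly F s = s" using inv \<open>s \<in> {a, b}\<close> FV s(2) by blast
    then have "s \<in> {z\<in>U. poly F z = s}" using \<open>s \<in> U\<close> by simp
    then have "c = s" by (simp add: c)
    then show ?thesis using \<open>poly (pderiv F) c = 0\<close> \<open>poly F c = s\<close> by blast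
  qed
qed

theorem theorem10p3:
  fixes P :: "complex poly"
  assumes "degree P \<ge> 2"
    and "finite (postcritical_set P)" and "card (postcritical_set P) = 2"
    and "\<forall>c\<in>crit_points P. \<not> periodic_point P c"
  shows "\<not> renormalizable P"
proof
  assume "renormalizable P"
  then obtain n U V \<delta> where like: "polynomial_like (poly_iter P n) U V \<delta>"
    and conn: "connected (filled_julia_restr (poly_iter P n) U)"
    and \<delta>: "2 \<le> \<delta>" "\<delta> < degree P ^ n"
    by (auto simp: renormalizable_def renormalization_def)
  obtain a b where ab: "postcritical_set P = {a, b}"
    using assms(3) by (auto simp: card_2_iff)
  have "\<delta> = degree (poly_iter P n) \<or>
    (\<exists>z. poly (pderiv (poly_iter P n)) z = 0 \<and> poly (poly_iter P n) z = z)"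
  proof (rule polynomial_like_full_degree_or_fixed_critical_point
      [OF _ like \<delta>(1) conn, where a = a and b = b])
    show "degree (poly_iter P n) > 0" using assms(1) by (simp add: degree_poly_iter)
  qed (use critical_value_poly_iter [of P n] postcritical_set_poly_iter [of _ P n] ab in auto)
  \<comment> \<open>The bound \<open>\<delta> < degree P ^ n\<close> excludes full degree, and a
    critical fixed point of the iterate would yield a periodic critical point of
    \<open>P\<close>.\<close>
  then show False
    using \<delta>(2) assms(4) fixed_critical_point_poly_iter [of P n] by (auto simp: degree_poly_iter)
qed

end
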